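(* Let $k\ge 2$ and $d\ge 1$ be integers, let $a_0(x),\dots,a_d(x)\in\mathbb{Z}[x]$ with $a_0(x)a_d(x)\neq0$, and suppose $F(x)\in\mathbb{Z}[[x]]$ satisfies $\sum_{i=0}^d a_i(x)F(x^{k^i})=0$. Let $a,b$ be integers with $a\neq0$ and $b\ge2$ such that $a/b$ is inside the radius of convergence of $F(x)$, $\log|a|/\log b\in[0,1/(d+2))$, and $a_0((a/b)^{k^n})\neq0$ for all $n\ge0$. Then $$\mu(F(a/b))\le 4^{H(k^d+1)d^2}k^{5d^2},$$ where $H=\max_{0\le i\le d}\{\deg a_i(x)\}$.
   Context: For a real number $\xi$, the irrationality exponent $\mu(\xi)$ is the supremum of the real numbers $\mu$ such that $0<|\xi-p/q|<q^{-\mu}$ has infinitely many solutions $(p,q)\in\mathbb{Z}\times\mathbb{N}$. *)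

theory Defs
  imports "HOL-Analysis.Analysis" "HOL-Computational_Algebra.Computational_Algebra"
begin

text \<open>
  The supremum is taken in the extended reals, so that it is \<open>\<infinity>\<close> for Liouville numbers.
  Denominators are positive, and the pairs \<open>(p, q)\<close> are not required to be coprime.
\<close>

definition irrationality_exponent :: "real \<Rightarrow> ereal" where
  "irrationality_exponent \<xi> =
     (SUP \<mu>\<in>{\<mu>::real. infinite {(p::int, q::nat). q > 0 \<and>
          0 < \<bar>\<xi> - of_int p / of_nat q\<bar> \<and>
          \<bar>\<xi> - of_int p / of_nat q\<bar> < of_nat q powr (- \<mu>)}}. ereal \<mu>)"

definition real_fps_of_int_fps :: "int fps \<Rightarrow> real fps" where
  "real_fps_of_int_fps F = Abs_fps (\<lambda>n. of_int (fps_nth F n))"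

end

theory Submission
  imports Defs
begin

text \<open>
  Put \<open>x\<^sub>n = (a/b) ^ (k ^ n)\<close> and \<open>\<xi> = F(a/b)\<close>.  Take simultaneous Pade approximants \<open>P\<^sub>j / Q\<close> of
  the functions \<open>F(x ^ (k ^ j))\<close>, \<open>j < d\<close>, with degrees at most \<open>N = d(d+2)H\<close> and remainders of
  order \<open>E = (d+1)(d+2)H + 1\<close>.  Evaluating them at \<open>x\<^sub>n\<close> and iterating the functional equation \<open>n\<close>
  times from \<open>x\<^sub>n\<close> down to \<open>a/b\<close> gives integers \<open>p\<^sub>n, q\<^sub>n\<close> such that, for large \<open>n\<close>,
  \<open>\<bar>q\<^sub>n\<bar> \<le> b ^ ((D + 1) k ^ n)\<close> and \<open>\<bar>q\<^sub>n \<xi> - p\<^sub>n\<bar> \<le> b powr (- k ^ n / 2)\<close>, where \<open>D = H(d+1)^2\<close>; the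
  second bound uses \<open>\<bar>a/b\<bar> < b powr (- (d+1)/(d+2))\<close>.

  For a fixed \<open>\<theta>\<close> the numbers \<open>L\<^sub>n\<close>, equal to \<open>p\<^sub>n - \<theta> q\<^sub>n\<close> before clearing denominators, satisfy a
  linear recurrence of order at most \<open>d + 1\<close>, with coefficients that are polynomials in \<open>x\<^sub>n\<close> and
  a leading coefficient that is nonzero for large \<open>n\<close>.  If \<open>p\<^sub>n / q\<^sub>n = \<theta>\<close> on a window of \<open>d + 1\<close>
  consecutive large indices, it therefore holds from there on, and \<open>\<xi> = \<theta>\<close> is rational.  So for
  irrational \<open>\<xi>\<close> every fraction differs from one of \<open>d + 1\<close> consecutive approximations, whence
  \<open>\<mu>(\<xi>) \<le> 1 + 2 (D + 1) k ^ (d + 1)\<close>, which is smaller than the claimed bound.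
\<close>

subsection \<open>The irrationality exponent\<close>

text \<open>If \<mu> > M, the lower bound confines every solution to bounded q, and each q admits
  only finitely many p.\<close>

lemma irrationality_exponent_leI:
  assumes "c > 0"
    and lower: "\<And>p q. q \<ge> N \<Longrightarrow> q > 0 \<Longrightarrow> 0 < \<bar>\<xi> - of_int p / of_nat q\<bar> \<Longrightarrow>
      c * of_nat q powr (- M) \<le> \<bar>\<xi> - of_int p / of_nat q\<bar>"
  shows "irrationality_exponent \<xi> \<le> ereal M"
  unfolding irrationality_exponent_def
proof (rule SUP_least, simp, rule ccontr)
  fix \<mu> :: real
  let ?S = "{(p::int, q::nat). q > 0 \<and> \<xi> \<noteq> of_int p / of_nat q \<and>
          \<bar>\<xi> - of_int p / of_nat q\<bar> < of_nat q powr (- \<mu>)}"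
  assume inf: "infinite ?S" and "\<not> \<mu> \<le> M"
  then have \<mu>: "\<mu> - M > 0" by simp
  \<comment> \<open>At \<open>q = R\<close> the bounds \<open>c * q powr (- M)\<close> and
    \<open>q powr (- \<mu>)\<close> coincide. \<open>K\<close> also covers the denominators below
    \<open>N\<close>, where no lower bound is assumed.\<close>
  define R where "R = (1 / c) powr (1 / (\<mu> - M))"
  define K where "K = max N (nat \<lceil>R\<rceil>)"
  have bound: "q \<le> K" if "(p, q) \<in> ?S" for p q
  proof (cases "q \<ge> N")
    case True
    have q: "real q > 0" using that by auto
    have "c * of_nat q powr (- M) \<le> \<bar>\<xi> - of_int p / of_nat q\<bar>"
      by (rule lower) (use that True in auto)
    also have "\<dots> < of_nat q powr (- \<mu>)" using that by auto
    finally have "c * real q powr (- M) * real q powr \<mu> < real q powr (- \<mu>) * real q powr \<mu>"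
      using q by (intro mult_strict_right_mono) auto
    then have "c * real q powr (\<mu> - M) < 1"
      using q by (simp add: powr_add[symmetric] mult.assoc)
    then have "real q powr (\<mu> - M) \<le> 1 / c" using assms(1) by (simp add: field_simps)
    then have "(real q powr (\<mu> - M)) powr (1 / (\<mu> - M)) \<le> R"
      unfolding R_def using \<mu> by (intro powr_mono2) auto
    then have "real q \<le> R" using \<mu> q by (simp add: powr_powr)
    then show ?thesis unfolding K_def by linarith
  qed (simp add: K_def)
  define P where "P q = {\<lfloor>real q * (\<xi> - real q powr (- \<mu>))\<rfloor>..\<lceil>real q * (\<xi> + real q powr (- \<mu>))\<rceil>}" for q
  have "?S \<subseteq> (\<Union>q\<le>K. P q \<times> {q})"
  proof (clarify)
    fix p q assume S: "q > 0" "\<xi> \<noteq> of_int p / of_nat q" "\<bar>\<xi> - of_int p / real q\<bar> < real q powr (- \<mu>)"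
    then have "real q * (\<xi> - real q powr (- \<mu>)) \<le> p" "p \<le> real q * (\<xi> + real q powr (- \<mu>))"
      by (auto simp: field_simps abs_less_iff)
    then have "p \<in> P q" unfolding P_def by (auto simp: le_ceiling_iff floor_le_iff)
    then show "(p, q) \<in> (\<Union>q\<le>K. P q \<times> {q})" using bound[of p q] S by auto
  qed
  moreover have "finite (\<Union>q\<le>K. P q \<times> {q})" by (auto simp: P_def)
  ultimately show False using inf finite_subset by blast
qed

text \<open>Distinct fractions with denominators b and q differ by at least 1/(bq).\<close>

lemma irrationality_exponent_Rats_le:
  assumes "\<xi> \<in> \<rat>"
  shows "irrationality_exponent \<xi> \<le> ereal 1"
proof -
  obtain a b :: int where ab: "b > 0" "\<xi> = of_int a / of_int b"
    using assms by (metis Rats_cases')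
  show ?thesis
  proof (rule irrationality_exponent_leI[of "1 / of_int b" 1])
    fix p :: int and q :: nat
    assume q: "q > 0" and ne: "0 < \<bar>\<xi> - of_int p / of_nat q\<bar>"
    have eq: "\<xi> - of_int p / of_nat q = of_int (a * int q - p * b) / (of_int b * of_nat q)"
      using ab q by (simp add: field_simps)
    have "a * int q - p * b \<noteq> 0"
    proof
      assume "a * int q - p * b = 0"
      then show False using ne unfolding eq by (simp del: of_int_diff of_int_mult)
    qed
    then have "1 \<le> \<bar>real_of_int (a * int q - p * b)\<bar>" by linarith
    then show "1 / of_int b * of_nat q powr - 1 \<le> \<bar>\<xi> - of_int p / of_nat q\<bar>"
      unfolding eq using ab(1) q by (simp add: abs_mult powr_minus_divide divide_right_mono del: of_int_diff of_int_mult)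
  qed (use ab in simp)
qed

text \<open>For a fraction r/s take the first n at which the error bound drops below 1/(2s), and an
  index m in n..n+g whose approximation differs from r/s. The integer q_m r - p_m s is nonzero and s
  |q_m \<xi> - p_m| is at most 1/2, so |q_m| |r - s \<xi>| is at least 1/2; minimality of n bounds
  |q_m| by a power of 2s.\<close>

lemma irrationality_exponent_le_of_approximations:
  fixes p q :: "nat \<Rightarrow> int"
  assumes \<beta>: "\<beta> > 1" and k: "k \<ge> (2::nat)" and \<delta>: "\<delta> > 0" and D: "D \<ge> 0"
    and denom: "\<And>n. n \<ge> n0 \<Longrightarrow> \<bar>real_of_int (q n)\<bar> \<le> \<beta> powr (D * real k ^ n)"
    and approx: "\<And>n. n \<ge> n0 \<Longrightarrow> \<bar>of_int (q n) * \<xi> - of_int (p n)\<bar> \<le> \<beta> powr (- \<delta> * real k ^ n)"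
    and distinct: "\<And>n r s. n \<ge> n0 \<Longrightarrow> s > 0 \<Longrightarrow> \<exists>m\<in>{n..n + g}. q m * r \<noteq> p m * s"
  shows "irrationality_exponent \<xi> \<le> ereal (1 + D / \<delta> * real k ^ (g + 1))"
proof -
  \<comment> \<open>The power \<open>g + 1\<close> counts the steps from index n - 1, where
    minimality bounds \<open>\<Lambda>\<close> by 2s, to the worst index n + g.\<close>
  define e where "e = D / \<delta> * real k ^ (g + 1)"
  define \<Lambda> where "\<Lambda> n = \<beta> powr (\<delta> * real k ^ n)" for n
  have kpos: "real k > 1" using k by simp
  have \<Lambda>_mono: "\<Lambda> m \<le> \<Lambda> n" if "m \<le> n" for m n
    unfolding \<Lambda>_def using that \<beta> \<delta> kpos by (intro powr_mono mult_left_mono power_increasing) auto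
  have \<Lambda>_pos: "\<Lambda> n > 0" for n using \<beta> by (simp add: \<Lambda>_def)
  have \<Lambda>_unbounded: "\<exists>n. X < \<Lambda> n" if "X > 0" for X
  proof -
    obtain n where n: "ln X / (\<delta> * ln \<beta>) < real k ^ n" using real_arch_pow[OF kpos] by blast
    then have "ln X < \<delta> * real k ^ n * ln \<beta>" using \<delta> \<beta> by (simp add: field_simps)
    then have "exp (ln X) < \<Lambda> n" unfolding \<Lambda>_def powr_def using \<beta> by (simp add: mult_ac)
    then show ?thesis using that by auto
  qed
  have e: "e \<ge> 0" using D \<delta> by (simp add: e_def)
  show ?thesis unfolding e_def[symmetric]
  \<comment> \<open>The 1/2 is what the approximation error leaves of a nonzero integer;
    \<open>2 powr (- e)\<close> undoes the 2 in the bound (2s)^e on |q_m|. The threshold on s forces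
    n > n0, so n has a predecessor.\<close>
  proof (rule irrationality_exponent_leI[of "2 powr (- e) / 2" "nat \<lceil>\<Lambda> n0\<rceil>"])
    fix r :: int and s :: nat
    assume s: "s \<ge> nat \<lceil>\<Lambda> n0\<rceil>" "s > 0"
    define n where "n = (LEAST n. 2 * real s < \<Lambda> n)"
    have n: "2 * real s < \<Lambda> n"
      unfolding n_def by (rule LeastI_ex) (use \<Lambda>_unbounded s in simp)
    have "\<Lambda> n0 \<le> real s" using s by linarith
    then have "\<Lambda> n0 < \<Lambda> n" using n s by linarith
    then have "n0 < n" using \<Lambda>_mono[of n n0] by force
    then obtain n' where n': "n = Suc n'" by (cases n) auto
    have prev: "\<Lambda> n' \<le> 2 * real s"
      using not_less_Least[of n' "\<lambda>n. 2 * real s < \<Lambda> n"] n' unfolding n_def by simp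
    obtain m where m: "m \<in> {n..n + g}" "q m * r \<noteq> p m * int s"
      using distinct[of n "int s" r] \<open>n0 < n\<close> s by auto
    have "\<bar>real_of_int (q m)\<bar> \<le> \<beta> powr (D * real k ^ m)"
      using m \<open>n0 < n\<close> by (intro denom) auto
    also have "\<dots> \<le> \<beta> powr (D * real k ^ (n + g))"
      using m \<beta> kpos D by (intro powr_mono mult_left_mono power_increasing) auto
    also have "\<dots> = \<Lambda> n' powr e"
      using \<delta> by (simp add: \<Lambda>_def e_def powr_powr n' power_add mult_ac)
    also have "\<dots> \<le> (2 * real s) powr e"
      using \<Lambda>_pos[of n'] prev e by (intro powr_mono2) auto
    finally have qm: "\<bar>real_of_int (q m)\<bar> \<le> 2 powr e * real s powr e" by (simp add: powr_mult)
    have "\<bar>of_int (q m) * \<xi> - of_int (p m)\<bar> \<le> \<beta> powr (- \<delta> * real k ^ m)"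
      using m \<open>n0 < n\<close> by (intro approx) auto
    also have "\<dots> = 1 / \<Lambda> m" by (simp add: \<Lambda>_def powr_minus_divide)
    also have "\<dots> \<le> 1 / \<Lambda> n" using \<Lambda>_mono[of n m] \<Lambda>_pos m by (auto intro: divide_left_mono)
    also have "\<dots> \<le> 1 / (2 * real s)" using n s by (intro divide_left_mono) (auto intro: less_trans)
    finally have "real s * \<bar>of_int (q m) * \<xi> - of_int (p m)\<bar> \<le> 1 / 2"
      using s by (simp add: field_simps)
    moreover have "1 \<le> \<bar>real_of_int (q m * r - p m * int s)\<bar>" using m(2) by linarith
    moreover have "real_of_int (q m * r - p m * int s) =
        of_int (q m) * (of_int r - real s * \<xi>) + real s * (of_int (q m) * \<xi> - of_int (p m))"
      by (simp add: algebra_simps)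
    then have "\<bar>real_of_int (q m * r - p m * int s)\<bar> \<le> \<bar>of_int (q m)\<bar> * \<bar>of_int r - real s * \<xi>\<bar> +
        real s * \<bar>of_int (q m) * \<xi> - of_int (p m)\<bar>"
      using abs_triangle_ineq[of "of_int (q m) * (of_int r - real s * \<xi>)"
          "real s * (of_int (q m) * \<xi> - of_int (p m))"] by (simp add: abs_mult)
    ultimately have "1 / 2 \<le> \<bar>of_int (q m)\<bar> * \<bar>of_int r - real s * \<xi>\<bar>" by linarith
    also have "\<dots> \<le> (2 powr e * real s powr e) * \<bar>of_int r - real s * \<xi>\<bar>"
      using qm by (intro mult_right_mono) auto
    also have "\<bar>of_int r - real s * \<xi>\<bar> = real s * \<bar>\<xi> - of_int r / real s\<bar>"
    proof -
      have "of_int r - real s * \<xi> = - (real s * (\<xi> - of_int r / real s))"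
        using s by (simp add: field_simps)
      then show ?thesis by (simp add: abs_mult)
    qed
    finally have "1 / 2 \<le> 2 powr e * (real s powr (1 + e) * \<bar>\<xi> - of_int r / real s\<bar>)"
      using s by (simp add: powr_add mult_ac)
    then have "2 powr (- e) / 2 \<le> real s powr (1 + e) * \<bar>\<xi> - of_int r / real s\<bar>"
      by (simp add: powr_minus field_simps)
    then show "2 powr (- e) / 2 * real s powr (- (1 + e)) \<le> \<bar>\<xi> - of_int r / real s\<bar>"
      using s by (simp add: powr_minus[of "real s" "1 + e"] field_simps del: minus_add_distrib)
  qed simp
qed

subsection \<open>Integer polynomials along an orbit of \<open>x \<mapsto> x ^ k\<close>\<close>

text \<open>Fraction-free Gaussian elimination: a pivot unknown is removed by cross-multiplication,
  and the solution of the smaller system is scaled by the pivot, so that no division occurs.\<close>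

lemma nontrivial_solution_idom:
  fixes M :: "'i \<Rightarrow> 'j \<Rightarrow> 'a::idom"
  assumes "finite I" "finite J" "card I < card J"
  shows "\<exists>x. (\<exists>j\<in>J. x j \<noteq> 0) \<and> (\<forall>i\<in>I. (\<Sum>j\<in>J. M i j * x j) = 0)"
  using assms
proof (induction I arbitrary: J M rule: finite_induct)
  case empty
  then obtain j where "j \<in> J" by fastforce
  then show ?case by (intro exI[of _ "\<lambda>_. 1"]) auto
next
  case (insert i I)
  show ?case
  proof (cases "\<forall>j\<in>J. M i j = 0")
    case True
    have "card I < card J" using insert by simp
    from insert.IH[OF insert.prems(1) this, of M] True show ?thesis by auto
  next
    case False
    then obtain p where p: "p \<in> J" "M i p \<noteq> 0" by blast
    have "card I < card (J - {p})" using insert p by simp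
    then obtain x where x: "\<exists>j\<in>J - {p}. x j \<noteq> 0"
      "\<forall>i'\<in>I. (\<Sum>j\<in>J - {p}. (M i p * M i' j - M i' p * M i j) * x j) = 0"
      using insert.IH[of "J - {p}" "\<lambda>i' j. M i p * M i' j - M i' p * M i j"] insert.prems(1) by auto
    define y where "y j = (if j = p then - (\<Sum>j\<in>J - {p}. M i j * x j) else M i p * x j)" for j
    have split: "(\<Sum>j\<in>J. M i' j * y j) =
        (\<Sum>j\<in>J - {p}. (M i p * M i' j - M i' p * M i j) * x j)" for i'
    proof -
      have "(\<Sum>j\<in>J. M i' j * y j) = M i' p * y p + (\<Sum>j\<in>J - {p}. M i' j * y j)"
        using p insert.prems(1) by (simp add: sum.remove)
      also have "(\<Sum>j\<in>J - {p}. M i' j * y j) = (\<Sum>j\<in>J - {p}. M i p * M i' j * x j)"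
        by (rule sum.cong) (auto simp: y_def)
      also have "M i' p * y p = - (\<Sum>j\<in>J - {p}. M i' p * M i j * x j)"
        by (simp add: y_def sum_distrib_left mult.assoc)
      finally show ?thesis by (simp add: sum_subtractf left_diff_distrib)
    qed
    have "(\<Sum>j\<in>J. M i j * y j) = 0"
      unfolding split by (simp add: mult.commute)
    moreover have "\<exists>j\<in>J. y j \<noteq> 0" using x(1) p by (auto simp: y_def)
    ultimately show ?thesis using x(2) split by (intro exI[of _ y]) auto
  qed
qed

abbreviation ipoly :: "int poly \<Rightarrow> real \<Rightarrow> real" where
  "ipoly p x \<equiv> poly (map_poly real_of_int p) x"

lemma ipoly_add: "ipoly (p + q) x = ipoly p x + ipoly q x"
proof -
  have "map_poly real_of_int (p + q) = map_poly real_of_int p + map_poly real_of_int q"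
    by (rule poly_eqI) (simp add: coeff_map_poly)
  then show ?thesis by simp
qed

lemma ipoly_minus: "ipoly (- p) x = - ipoly p x"
proof -
  have "map_poly real_of_int (- p) = - map_poly real_of_int p"
    by (rule poly_eqI) (simp add: coeff_map_poly)
  then show ?thesis by simp
qed

lemma ipoly_mult: "ipoly (p * q) x = ipoly p x * ipoly q x"
proof -
  have "map_poly real_of_int (p * q) = map_poly real_of_int p * map_poly real_of_int q"
    by (rule poly_eqI) (simp add: coeff_map_poly coeff_mult)
  then show ?thesis by simp
qed

lemma ipoly_sum: "ipoly (\<Sum>i\<in>S. f i) x = (\<Sum>i\<in>S. ipoly (f i) x)"
  by (induction S rule: infinite_finite_induct) (auto simp: ipoly_add)

lemma ipoly_pcompose_monom: "ipoly (pcompose p (monom 1 k)) x = ipoly p (x ^ k)"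
  by (induction p)
    (simp_all add: pcompose_pCons ipoly_add ipoly_mult map_poly_pCons map_poly_monom poly_monom)

lemma finite_ipoly_zeros_seq:
  assumes "p \<noteq> 0" "inj u"
  shows "finite {n::nat. ipoly p (u n) = 0}"
proof -
  have "map_poly real_of_int p \<noteq> 0" using assms(1) by (simp add: map_poly_eq_0_iff)
  then have "finite {x. ipoly p x = 0}" by (rule poly_roots_finite)
  from finite_vimageI[OF this assms(2)] show ?thesis by (simp add: vimage_def)
qed

lemma ipoly_Ints_scaled:
  fixes a b :: int
  assumes "b \<noteq> 0" "degree p \<le> N"
  shows "of_int b ^ (N * m) * ipoly p ((of_int a / of_int b) ^ m) \<in> \<int>"
proof -
  have "ipoly p y = (\<Sum>i\<le>N. of_int (coeff p i) * y ^ i)" for y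
  proof -
    have "degree (map_poly real_of_int p) \<le> N"
      using assms(2) map_poly_degree_leq[of real_of_int p] by linarith
    then have "ipoly p y = (\<Sum>i\<le>N. coeff (map_poly real_of_int p) i * y ^ i)"
      unfolding poly_altdef by (intro sum.mono_neutral_left) (auto simp: coeff_eq_0)
    then show ?thesis by (simp add: coeff_map_poly)
  qed
  then have "of_int b ^ (N * m) * ipoly p ((of_int a / of_int b) ^ m) =
     (\<Sum>i\<le>N. of_int (coeff p i) * (of_int b ^ (N * m) * ((of_int a / of_int b) ^ m) ^ i))"
    by (simp add: sum_distrib_left mult_ac)
  also have "\<dots> = (\<Sum>i\<le>N. of_int (coeff p i * b ^ ((N - i) * m) * a ^ (m * i)))"
  proof (rule sum.cong)
    fix i assume "i \<in> {..N}"
    then have e: "N * m = (N - i) * m + m * i" by (simp add: algebra_simps diff_mult_distrib)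
    have "real_of_int b ^ (N * m) * ((of_int a / of_int b) ^ m) ^ i =
       of_int b ^ ((N - i) * m) * of_int a ^ (m * i)"
      unfolding e power_add using assms(1) by (simp add: power_divide power_mult)
    then show "of_int (coeff p i) * (real_of_int b ^ (N * m) * ((of_int a / of_int b) ^ m) ^ i) =
      of_int (coeff p i * b ^ ((N - i) * m) * a ^ (m * i))" by simp
  qed simp
  also have "\<dots> \<in> \<int>" by (intro Ints_sum) simp
  finally show ?thesis .
qed

lemma ipoly_bounded_unit:
  obtains B where "B > 0" "\<And>x. \<bar>x\<bar> \<le> 1 \<Longrightarrow> \<bar>ipoly p x\<bar> \<le> B"
proof -
  have "compact ((\<lambda>x. ipoly p x) ` cball 0 1)"
    by (intro compact_continuous_image continuous_intros) auto
  then obtain B where "B > 0" "\<forall>x\<in>cball 0 1. norm (ipoly p x) \<le> B"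
    using compact_imp_bounded bounded_pos by (metis (no_types, lifting) image_eqI)
  then show ?thesis using that[of B] by auto
qed

section \<open>Products of polynomial matrices along the orbit\<close>

text \<open>The row \<open>w\<close> times the matrix product T(x) T(x^k) ...
  T(x^(k^(n-1))).\<close>

primrec transfer_row :: "('i \<Rightarrow> 'i \<Rightarrow> int poly) \<Rightarrow> 'i set \<Rightarrow> nat \<Rightarrow> real \<Rightarrow> ('i \<Rightarrow> real) \<Rightarrow> nat \<Rightarrow> 'i \<Rightarrow> real" where
  "transfer_row T I k x w 0 j = w j"
| "transfer_row T I k x w (Suc n) j = (\<Sum>i\<in>I. transfer_row T I k x w n i * ipoly (T i j) (x ^ (k ^ n)))"

lemma transfer_row_linear:
  "transfer_row T I k x (\<lambda>j. c * v j + w j) n j = c * transfer_row T I k x v n j + transfer_row T I k x w n j"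
  by (induction n arbitrary: j) (simp_all add: sum_distrib_left algebra_simps sum.distrib)

lemma transfer_row_Ints:
  fixes a b :: int
  assumes "b \<noteq> 0" "\<And>i j. i \<in> I \<Longrightarrow> j \<in> I \<Longrightarrow> degree (T i j) \<le> H"
    "\<And>j. j \<in> I \<Longrightarrow> w j \<in> \<int>" "j \<in> I"
  shows "of_int b ^ (H * (\<Sum>i<n. k ^ i)) * transfer_row T I k (of_int a / of_int b) w n j \<in> \<int>"
  using assms(4)
proof (induction n arbitrary: j)
  case 0 then show ?case using assms(3) by simp
next
  case (Suc n)
  let ?r = "transfer_row T I k (of_int a / of_int b) w n" and ?x = "(of_int a / of_int b) ^ (k ^ n) :: real"
  have "of_int b ^ (H * (\<Sum>i<Suc n. k ^ i)) * transfer_row T I k (of_int a / of_int b) w (Suc n) j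
     = (\<Sum>i\<in>I. (of_int b ^ (H * (\<Sum>i<n. k ^ i)) * ?r i) *
           (of_int b ^ (H * k ^ n) * ipoly (T i j) ?x))"
    by (simp add: sum_distrib_left distrib_left power_add mult_ac)
  also have "\<dots> \<in> \<int>"
    using Suc assms(1,2) by (intro Ints_sum Ints_mult[OF Suc.IH] ipoly_Ints_scaled) auto
  finally show ?case .
qed

text \<open>All evaluation points lie in [-1, 1], where the entries of \<open>T\<close> are bounded.
  The growth is thus only exponential in n, negligible against a power of b with exponent
  proportional to k^n.\<close>

lemma transfer_row_bound:
  assumes "finite I" "\<bar>x\<bar> \<le> 1"
  obtains C where "C \<ge> 1" "\<And>n j. j \<in> I \<Longrightarrow> \<bar>transfer_row T I k x w n j\<bar> \<le> C ^ Suc n"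
proof -
  have "\<forall>p. \<exists>B>0. \<forall>x. \<bar>x\<bar> \<le> 1 \<longrightarrow> \<bar>ipoly p x\<bar> \<le> B" by (metis ipoly_bounded_unit)
  then obtain \<beta> where \<beta>: "\<And>p. \<beta> p > 0" "\<And>p x. \<bar>x\<bar> \<le> 1 \<Longrightarrow> \<bar>ipoly p x\<bar> \<le> \<beta> p" by metis
  \<comment> \<open>\<open>C\<close> dominates both the starting row and the sum of all entry
    bounds, so each step costs one factor \<open>C\<close>.\<close>
  define C where "C = 1 + (\<Sum>i\<in>I. \<Sum>j\<in>I. \<beta> (T i j)) + (\<Sum>j\<in>I. \<bar>w j\<bar>)"
  have nn: "(\<Sum>i\<in>I. \<Sum>j\<in>I. \<beta> (T i j)) \<ge> 0" "(\<Sum>j\<in>I. \<bar>w j\<bar>) \<ge> 0"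
    by (intro sum_nonneg less_imp_le \<beta>(1)) (auto intro: sum_nonneg)
  then have C1: "C \<ge> 1" by (simp add: C_def)
  have "\<bar>transfer_row T I k x w n j\<bar> \<le> C ^ Suc n" if "j \<in> I" for n j
    using that
  proof (induction n arbitrary: j)
    case 0
    have "\<bar>w j\<bar> \<le> (\<Sum>j\<in>I. \<bar>w j\<bar>)" using 0 assms by (intro member_le_sum) auto
    then show ?case using nn by (simp add: C_def)
  next
    case (Suc n)
    have x: "\<bar>x ^ (k ^ n)\<bar> \<le> 1" using assms by (simp add: power_abs power_le_one)
    have "\<bar>transfer_row T I k x w (Suc n) j\<bar> \<le> (\<Sum>i\<in>I. \<bar>transfer_row T I k x w n i * ipoly (T i j) (x ^ (k ^ n))\<bar>)"
      by (simp add: sum_abs)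
    also have "\<dots> \<le> (\<Sum>i\<in>I. C ^ Suc n * \<beta> (T i j))"
      unfolding abs_mult using Suc.IH \<beta>(2)[OF x] C1
      by (intro sum_mono mult_mono) auto
    also have "\<dots> \<le> (\<Sum>i\<in>I. C ^ Suc n * (\<Sum>j\<in>I. \<beta> (T i j)))"
      using C1 Suc.prems assms \<beta>(1) by (intro sum_mono mult_left_mono member_le_sum) (auto intro: less_imp_le)
    also have "\<dots> = C ^ Suc n * (\<Sum>i\<in>I. \<Sum>j\<in>I. \<beta> (T i j))" by (simp add: sum_distrib_left)
    also have "\<dots> \<le> C ^ Suc n * C" using C1 nn by (intro mult_left_mono) (auto simp: C_def)
    finally show ?case by (simp add: mult_ac)
  qed
  with C1 that show ?thesis by blast
qed

text \<open>The column T(x) T(x^k) ... T(x^(k^(m-1))) v(x^(k^m)), kept as polynomials in x.\<close>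

primrec pullback :: "('i \<Rightarrow> 'i \<Rightarrow> int poly) \<Rightarrow> 'i set \<Rightarrow> nat \<Rightarrow> ('i \<Rightarrow> int poly) \<Rightarrow> nat \<Rightarrow> 'i \<Rightarrow> int poly" where
  "pullback T I k v 0 i = v i"
| "pullback T I k v (Suc m) i = (\<Sum>j\<in>I. T i j * pcompose (pullback T I k v m j) (monom 1 k))"

text \<open>Associativity: of the n + m matrix factors, the first n stay in the row and the last m
  move into the column.\<close>

lemma transfer_row_pullback:
  "(\<Sum>j\<in>I. transfer_row T I k x w (n + m) j * ipoly (v j) (x ^ (k ^ (n + m)))) =
   (\<Sum>j\<in>I. transfer_row T I k x w n j * ipoly (pullback T I k v m j) (x ^ (k ^ n)))"
proof (induction m arbitrary: n)
  case (Suc m)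
  have "(\<Sum>j\<in>I. transfer_row T I k x w (n + Suc m) j * ipoly (v j) (x ^ (k ^ (n + Suc m)))) =
    (\<Sum>j\<in>I. transfer_row T I k x w (Suc n) j * ipoly (pullback T I k v m j) (x ^ (k ^ Suc n)))"
    using Suc.IH[of "Suc n"] by simp
  also have "\<dots> = (\<Sum>j\<in>I. \<Sum>i\<in>I. transfer_row T I k x w n i * (ipoly (T i j) (x ^ (k ^ n)) *
      ipoly (pullback T I k v m j) ((x ^ (k ^ n)) ^ k)))"
    by (simp add: sum_distrib_left power_mult[symmetric] mult_ac)
  also have "\<dots> = (\<Sum>i\<in>I. \<Sum>j\<in>I. transfer_row T I k x w n i * (ipoly (T i j) (x ^ (k ^ n)) *
      ipoly (pullback T I k v m j) ((x ^ (k ^ n)) ^ k)))"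
    by (rule sum.swap)
  also have "\<dots> = (\<Sum>i\<in>I. transfer_row T I k x w n i * ipoly (pullback T I k v (Suc m) i) (x ^ (k ^ n)))"
    by (simp add: ipoly_sum ipoly_mult ipoly_pcompose_monom sum_distrib_left)
  finally show ?case .
qed simp

text \<open>
  The vectors \<open>pullback T I k v m\<close> for \<open>m \<le> card I\<close> are linearly dependent over the field of
  rational functions.  A dependency relation holds at all points \<open>x ^ (k ^ n)\<close> simultaneously, and
  it becomes a recurrence of bounded order.
\<close>
lemma vanishing_propagates:
  fixes T :: "'i \<Rightarrow> 'i \<Rightarrow> int poly"
  assumes "finite I" "inj (\<lambda>n::nat. x ^ (k ^ n))"
  obtains n0 where
    "\<And>w n m. n \<ge> n0 \<Longrightarrow> n \<le> m \<Longrightarrow>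
      (\<And>l. l \<in> {n..<n + card I} \<Longrightarrow> (\<Sum>j\<in>I. transfer_row T I k x w l j * ipoly (v j) (x ^ (k ^ l))) = 0) \<Longrightarrow>
      (\<Sum>j\<in>I. transfer_row T I k x w m j * ipoly (v j) (x ^ (k ^ m))) = 0"
proof -
  let ?V = "pullback T I k v"
  \<comment> \<open>There are \<open>card I + 1\<close> columns with \<open>card I\<close>
    coordinates each, hence a nontrivial relation with polynomial coefficients.\<close>
  obtain c where c: "\<exists>m\<in>{..card I}. c m \<noteq> 0" "\<forall>i\<in>I. (\<Sum>m\<le>card I. ?V m i * c m) = 0"
    using nontrivial_solution_idom[OF assms(1), of "{..card I}" "\<lambda>i m. ?V m i"] by auto
  define r where "r = Max {m. m \<le> card I \<and> c m \<noteq> 0}"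
  have fin: "finite {m. m \<le> card I \<and> c m \<noteq> 0}" by simp
  have "r \<in> {m. m \<le> card I \<and> c m \<noteq> 0}"
    unfolding r_def using c(1) by (intro Max_in fin) auto
  then have r: "r \<le> card I" "c r \<noteq> 0" by auto
  have r_max: "c m = 0" if "m \<le> card I" "m > r" for m
    using that Max_ge[OF fin, of m] unfolding r_def by fastforce
  have dep: "(\<Sum>m\<le>r. c m * ?V m i) = 0" if "i \<in> I" for i
  proof -
    have "(\<Sum>m\<le>r. c m * ?V m i) = (\<Sum>m\<le>card I. c m * ?V m i)"
      by (rule sum.mono_neutral_left) (use r(1) r_max in \<open>auto simp: not_le\<close>)
    then show ?thesis using c(2) that by (simp add: mult.commute)
  qed
  \<comment> \<open>The leading coefficient \<open>c r\<close> vanishes at only finitely many orbit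
    points. Since \<open>c r\<close> does not involve the row, one \<open>n0\<close> serves every
    \<open>w\<close>.\<close>
  obtain n0 where n0: "\<And>n. n \<ge> n0 \<Longrightarrow> ipoly (c r) (x ^ (k ^ n)) \<noteq> 0"
    using finite_ipoly_zeros_seq[OF r(2) assms(2)]
    by (metis (mono_tags, lifting) finite_nat_set_iff_bounded mem_Collect_eq not_le)
  show ?thesis
  proof (rule that[of n0])
    fix w n m
    let ?L = "\<lambda>m. \<Sum>j\<in>I. transfer_row T I k x w m j * ipoly (v j) (x ^ (k ^ m))"
    assume n: "n \<ge> n0" and m: "n \<le> m" and window: "\<And>l. l \<in> {n..<n + card I} \<Longrightarrow> ?L l = 0"
    have rec: "(\<Sum>m\<le>r. ipoly (c m) (x ^ (k ^ n)) * ?L (n + m)) = 0" for n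
    proof -
      let ?y = "x ^ (k ^ n)"
      have "(\<Sum>m\<le>r. ipoly (c m) ?y * ?L (n + m)) =
          (\<Sum>m\<le>r. \<Sum>j\<in>I. transfer_row T I k x w n j * (ipoly (c m) ?y * ipoly (?V m j) ?y))"
        unfolding transfer_row_pullback by (simp add: sum_distrib_left mult_ac)
      also have "\<dots> = (\<Sum>j\<in>I. \<Sum>m\<le>r. transfer_row T I k x w n j * (ipoly (c m) ?y * ipoly (?V m j) ?y))"
        by (rule sum.swap)
      also have "\<dots> = (\<Sum>j\<in>I. transfer_row T I k x w n j * ipoly (\<Sum>m\<le>r. c m * ?V m j) ?y)"
        by (simp add: ipoly_sum ipoly_mult sum_distrib_left)
      also have "\<dots> = 0" using dep by simp
      finally show ?thesis .
    qed
    show "?L m = 0" using m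
    proof (induction m rule: less_induct)
      case (less m)
      show ?case
      proof (cases "m < n + card I")
        case True then show ?thesis using window less.prems by simp
      next
        case False
        \<comment> \<open>The recurrence based at \<open>l\<close> has \<open>?L m\<close> as its
          top term; \<open>l\<close> is still at least \<open>n\<close> because \<open>r\<close> is
          at most \<open>card I\<close>.\<close>
        define l where "l = m - r"
        have l: "l \<ge> n" "m = l + r" using False r(1) less.prems by (auto simp: l_def)
        have "(\<Sum>m\<le>r. ipoly (c m) (x ^ (k ^ l)) * ?L (l + m)) =
            (\<Sum>m<r. ipoly (c m) (x ^ (k ^ l)) * ?L (l + m)) + ipoly (c r) (x ^ (k ^ l)) * ?L m"
          using l(2) by (simp add: lessThan_Suc_atMost[symmetric])
        also have "(\<Sum>m<r. ipoly (c m) (x ^ (k ^ l)) * ?L (l + m)) = 0"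
          using less.IH l by (intro sum.neutral) auto
        finally have "ipoly (c r) (x ^ (k ^ l)) * ?L m = 0" using rec[of l] by simp
        then show ?thesis using n0[of l] l n by auto
      qed
    qed
  qed
qed

subsection \<open>Integer power series at real points\<close>

lemma real_fps_of_int_fps_nth [simp]: "real_fps_of_int_fps F $ n = of_int (F $ n)"
  by (simp add: real_fps_of_int_fps_def)

lemma real_fps_of_int_fps_0 [simp]: "real_fps_of_int_fps 0 = 0"
  by (rule fps_ext) simp

lemma real_fps_of_int_fps_add:
  "real_fps_of_int_fps (F + G) = real_fps_of_int_fps F + real_fps_of_int_fps G"
  by (rule fps_ext) simp

lemma real_fps_of_int_fps_diff:
  "real_fps_of_int_fps (F - G) = real_fps_of_int_fps F - real_fps_of_int_fps G"
  by (rule fps_ext) simp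

lemma real_fps_of_int_fps_mult:
  "real_fps_of_int_fps (F * G) = real_fps_of_int_fps F * real_fps_of_int_fps G"
  by (rule fps_ext) (simp add: fps_mult_nth)

lemma real_fps_of_int_fps_of_poly:
  "real_fps_of_int_fps (fps_of_poly p) = fps_of_poly (map_poly real_of_int p)"
  by (rule fps_ext) (simp add: coeff_map_poly)

lemma fps_nth_compose_X_power:
  fixes F :: "'a::comm_ring_1 fps"
  assumes "m > 0"
  shows "(F oo fps_X ^ m) $ n = (if m dvd n then F $ (n div m) else 0)"
proof -
  have "(F oo fps_X ^ m) $ n = (\<Sum>i=0..n. F $ i * (if n = m * i then 1 else 0))"
    by (simp add: fps_compose_nth power_mult[symmetric])
  also have "\<dots> = (\<Sum>i\<in>{0..n} \<inter> {i. n = m * i}. F $ i)"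
    by (rule sum.mono_neutral_cong_right) auto
  also have "{0..n} \<inter> {i. n = m * i} = (if m dvd n then {n div m} else {})"
    using assms by auto
  finally show ?thesis by simp
qed

text \<open>As |x| < 1, the point x^m stays in the disc of convergence, and the composed series at x
  is the original one at x^m with zero terms inserted.\<close>

lemma eval_compose_X_power:
  fixes F :: "int fps"
  assumes m: "m > 0" and x: "\<bar>x\<bar> < 1" "ereal \<bar>x\<bar> < fps_conv_radius (real_fps_of_int_fps F)"
  shows "ereal \<bar>x\<bar> < fps_conv_radius (real_fps_of_int_fps (F oo fps_X ^ m))" (is "_ < ?R'")
    and "eval_fps (real_fps_of_int_fps (F oo fps_X ^ m)) x = eval_fps (real_fps_of_int_fps F) (x ^ m)"
proof -
  let ?F = "real_fps_of_int_fps F" and ?G = "real_fps_of_int_fps (F oo fps_X ^ m)"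
  have sums: "(\<lambda>n. ?G $ n * y ^ n) sums eval_fps ?F (y ^ m)"
    if y: "\<bar>y\<bar> < 1" "ereal \<bar>y\<bar> < fps_conv_radius ?F" for y
  proof -
    have "\<bar>y\<bar> ^ m \<le> \<bar>y\<bar>" using y(1) m power_decreasing[of 1 m "\<bar>y\<bar>"] by simp
    then have "ereal (norm (y ^ m)) < fps_conv_radius ?F"
      using y(2) by (simp add: power_abs le_less_trans[of _ "ereal \<bar>y\<bar>"])
    from sums_eval_fps[OF this]
    have "(\<lambda>n. ?G $ (m * n) * y ^ (m * n)) sums eval_fps ?F (y ^ m)"
      using m by (simp add: fps_nth_compose_X_power power_mult)
    then show ?thesis
      using m by (subst (asm) sums_mono_reindex[of "\<lambda>n. m * n"])
        (auto simp: strict_mono_def fps_nth_compose_X_power image_iff elim!: dvdE)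
  qed
  \<comment> \<open>Convergence at a point strictly beyond |x| yields the strict inequality for the
    radius.\<close>
  obtain y where y: "\<bar>x\<bar> < y" "ereal y < min 1 (fps_conv_radius ?F)"
    using ereal_dense2[of "ereal \<bar>x\<bar>" "min 1 (fps_conv_radius ?F)"] x by (auto simp: one_ereal_def)
  then have "ereal (norm y) \<le> conv_radius (fps_nth ?G)"
    by (intro conv_radius_geI sums_summable[OF sums]) (auto simp: one_ereal_def)
  moreover have "ereal \<bar>x\<bar> < ereal (norm y)" using y(1) by simp
  ultimately show "ereal \<bar>x\<bar> < ?R'" unfolding fps_conv_radius_def by (rule less_le_trans[rotated])
  then have "(\<lambda>n. ?G $ n * x ^ n) sums eval_fps ?G x" by (intro sums_eval_fps) simp
  then show "eval_fps ?G x = eval_fps ?F (x ^ m)" using sums[OF x] sums_unique2 by blast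
qed

lemma eval_mult_fps_of_poly:
  assumes "ereal \<bar>x\<bar> < fps_conv_radius (real_fps_of_int_fps F)"
  shows "ereal \<bar>x\<bar> < fps_conv_radius (real_fps_of_int_fps (fps_of_poly p * F))"
    and "eval_fps (real_fps_of_int_fps (fps_of_poly p * F)) x =
      ipoly p x * eval_fps (real_fps_of_int_fps F) x"
proof -
  show "ereal \<bar>x\<bar> < fps_conv_radius (real_fps_of_int_fps (fps_of_poly p * F))"
    unfolding real_fps_of_int_fps_mult real_fps_of_int_fps_of_poly
    by (rule less_le_trans[OF _ fps_conv_radius_mult]) (use assms in simp)
  show "eval_fps (real_fps_of_int_fps (fps_of_poly p * F)) x =
      ipoly p x * eval_fps (real_fps_of_int_fps F) x"
    unfolding real_fps_of_int_fps_mult real_fps_of_int_fps_of_poly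
    by (subst eval_fps_mult) (use assms in auto)
qed

lemma eval_sum_int_fps:
  assumes "\<And>i. i \<in> S \<Longrightarrow> ereal \<bar>x\<bar> < fps_conv_radius (real_fps_of_int_fps (f i))"
  shows "ereal \<bar>x\<bar> < fps_conv_radius (real_fps_of_int_fps (\<Sum>i\<in>S. f i)) \<and>
    eval_fps (real_fps_of_int_fps (\<Sum>i\<in>S. f i)) x = (\<Sum>i\<in>S. eval_fps (real_fps_of_int_fps (f i)) x)"
  using assms
proof (induction S rule: infinite_finite_induct)
  case (insert i S)
  then have rad: "ereal \<bar>x\<bar> < fps_conv_radius (real_fps_of_int_fps (f i))"
    "ereal \<bar>x\<bar> < fps_conv_radius (real_fps_of_int_fps (\<Sum>i\<in>S. f i))" by auto
  then have "ereal \<bar>x\<bar> < fps_conv_radius (real_fps_of_int_fps (f i) + real_fps_of_int_fps (\<Sum>i\<in>S. f i))"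
    by (intro less_le_trans[OF _ fps_conv_radius_add]) simp
  then show ?case using insert rad by (simp add: real_fps_of_int_fps_add eval_fps_add)
qed auto

text \<open>After y^E is factored out, the shifted series is continuous, hence bounded on the
  compact interval.\<close>

lemma eval_fps_high_order:
  fixes G :: "real fps"
  assumes "\<And>e. e < E \<Longrightarrow> G $ e = 0" and s: "s \<ge> 0" "ereal s < fps_conv_radius G"
  obtains C where "C \<ge> 0" "\<And>y. \<bar>y\<bar> \<le> s \<Longrightarrow> \<bar>eval_fps G y\<bar> \<le> C * \<bar>y\<bar> ^ E"
proof -
  let ?S = "fps_shift E G"
  have split: "G = ?S * fps_X ^ E"
    using assms(1) by (intro fps_ext) (simp add: fps_X_power_mult_right_nth)
  have rad: "ereal \<bar>y\<bar> < fps_conv_radius G" if "\<bar>y\<bar> \<le> s" for y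
    using that s(2) by (metis ereal_less_eq(3) le_less_trans)
  have "continuous_on (cball 0 s) (eval_fps ?S)"
    by (intro continuous_on_eval_fps' continuous_on_subset[OF continuous_on_eval_fps])
      (use rad in auto)
  then have "bounded (eval_fps ?S ` cball 0 s)"
    by (intro compact_imp_bounded compact_continuous_image) auto
  then obtain C where C: "C > 0" "\<And>y. \<bar>y\<bar> \<le> s \<Longrightarrow> \<bar>eval_fps ?S y\<bar> \<le> C"
    unfolding bounded_pos by auto
  have "\<bar>eval_fps G y\<bar> \<le> C * \<bar>y\<bar> ^ E" if "\<bar>y\<bar> \<le> s" for y
  proof -
    have "eval_fps G y = eval_fps ?S y * y ^ E"
      using rad[OF that] by (subst split, subst eval_fps_mult) auto
    then show ?thesis using C(2)[OF that] by (simp add: abs_mult power_abs mult_right_mono)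
  qed
  then show ?thesis using that[of C] C(1) by simp
qed

subsection \<open>Simultaneous Pade approximation of Mahler functions\<close>

text \<open>A count of unknowns: Q has \<open>d * t + 1\<close> coefficients, while killing the
  coefficients of each \<open>Q * f i\<close> at the \<open>t\<close> exponents above
  \<open>d * t\<close> imposes \<open>d * t\<close> conditions. The lower coefficients go into
  \<open>P i\<close>.\<close>

lemma simultaneous_Pade:
  fixes f :: "nat \<Rightarrow> int fps"
  obtains Q P where "Q \<noteq> 0" "degree Q \<le> d * t" "\<And>i. degree (P i) \<le> d * t"
    "\<And>i e. i < d \<Longrightarrow> e < (d + 1) * t + 1 \<Longrightarrow> (fps_of_poly Q * f i - fps_of_poly (P i)) $ e = 0"
proof -
  let ?N = "d * t" and ?I = "{..<d} \<times> {d * t<..(d + 1) * t}"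
  have "card ?I < card {..?N}" by (simp add: card_cartesian_product)
  \<comment> \<open>Here e > d * t and l is at most d * t, so \<open>e - l\<close> is a genuine
    difference.\<close>
  from nontrivial_solution_idom[OF _ _ this, of "\<lambda>(i, e) l. f i $ (e - l)"]
  obtain c where c: "\<exists>l\<in>{..?N}. c l \<noteq> 0"
    "\<forall>(i, e)\<in>?I. (\<Sum>l\<le>?N. f i $ (e - l) * c l) = 0"
    by (auto simp: case_prod_beta)
  define Q where "Q = truncate_fps (Suc ?N) (Abs_fps c)"
  define P where "P i = truncate_fps (Suc ?N) (fps_of_poly Q * f i)" for i
  have Q: "coeff Q l = (if l \<le> ?N then c l else 0)" for l
    by (auto simp: Q_def coeff_truncate_fps)
  show ?thesis
  proof (rule that[of Q P])
    show "Q \<noteq> 0" using c(1) Q by (metis atMost_iff coeff_0)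
    show "degree Q \<le> ?N" unfolding Q_def using degree_truncate_fps[of "Suc ?N"] by (simp add: less_Suc_eq_le)
    show "degree (P i) \<le> ?N" for i
      unfolding P_def using degree_truncate_fps[of "Suc ?N"] by (simp add: less_Suc_eq_le)
    fix i e assume i: "i < d" and e: "e < (d + 1) * t + 1"
    show "(fps_of_poly Q * f i - fps_of_poly (P i)) $ e = 0"
    proof (cases "e \<le> ?N")
      case True then show ?thesis by (simp add: P_def coeff_truncate_fps)
    next
      case False
      have "(fps_of_poly Q * f i) $ e = (\<Sum>l=0..e. coeff Q l * f i $ (e - l))"
        by (simp add: fps_mult_nth)
      also have "\<dots> = (\<Sum>l\<le>?N. f i $ (e - l) * c l)"
        by (rule sum.mono_neutral_cong_right) (use False in \<open>auto simp: Q\<close>)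
      also have "\<dots> = 0" using c(2) i e False by auto
      finally show ?thesis using False by (simp add: P_def coeff_truncate_fps)
    qed
  qed
qed

text \<open>The logarithm of the left side grows at most linearly in n, and (n+1)/2^(n+1) tends to
  0.\<close>

lemma eventually_exponential_le:
  fixes K C b \<epsilon> :: real
  assumes "C \<ge> 1" "b > 1" "\<epsilon> > 0" "k \<ge> (2::nat)"
  shows "eventually (\<lambda>n. K * C ^ Suc n \<le> b powr (\<epsilon> * real k ^ n)) sequentially"
proof -
  \<comment> \<open>With \<open>max 1 K\<close> the constant can be absorbed into the power, giving
    the bound exp((n+1)c). The threshold below uses \<open>c + 1\<close> because \<open>c\<close>
    may be 0.\<close>
  define c where "c = ln (max 1 K * C)"
  have MC: "max 1 K * C \<ge> 1" using assms(1) mult_mono[of 1 "max 1 K" 1 C] by simp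
  then have c: "c \<ge> 0" by (simp add: c_def)
  have "(\<lambda>n. real (Suc n) * (1 / 2) ^ Suc n) \<longlonglongrightarrow> 0"
    by (rule LIMSEQ_Suc[OF powser_times_n_limit_0]) simp
  moreover have "\<epsilon> * ln b / (2 * (c + 1)) > 0" using assms c by simp
  ultimately have "eventually (\<lambda>n. real (Suc n) * (1 / 2) ^ Suc n < \<epsilon> * ln b / (2 * (c + 1))) sequentially"
    by (rule order_tendstoD(2))
  then show ?thesis
  proof eventually_elim
    case (elim n)
    then have "real (Suc n) * (c + 1) \<le> \<epsilon> * ln b * 2 ^ n"
      using c by (simp add: field_simps)
    also have "\<dots> \<le> \<epsilon> * ln b * real k ^ n"
      using assms by (intro mult_left_mono power_mono) auto
    finally have exponent: "real (Suc n) * c \<le> \<epsilon> * real k ^ n * ln b"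
      by (simp add: algebra_simps)
    have "K * C ^ Suc n \<le> max 1 K ^ Suc n * C ^ Suc n"
    proof (rule mult_right_mono)
      have "K \<le> max 1 K ^ 1" by simp
      also have "\<dots> \<le> max 1 K ^ Suc n" by (intro power_increasing) auto
      finally show "K \<le> max 1 K ^ Suc n" .
    qed (use assms in simp)
    also have "\<dots> = (max 1 K * C) ^ Suc n" by (simp only: power_mult_distrib)
    also have "\<dots> = exp (real (Suc n) * c)"
      using MC by (subst exp_of_nat_mult) (simp add: c_def)
    also have "\<dots> \<le> exp (\<epsilon> * real k ^ n * ln b)" using exponent by simp
    also have "\<dots> = b powr (\<epsilon> * real k ^ n)" using assms by (simp add: powr_def)
    finally show ?case .
  qed
qed

text \<open>
  The index \<open>d\<close> belongs to the constant function 1 and the indices \<open>j < d\<close> to \<open>F(x ^ (k ^ j))\<close>: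
  the matrix expresses \<open>a\<^sub>0(x)\<close> times these functions at \<open>x\<close> through their values at \<open>x ^ k\<close>.
\<close>
definition companion :: "nat \<Rightarrow> (nat \<Rightarrow> int poly) \<Rightarrow> nat \<Rightarrow> nat \<Rightarrow> int poly" where
  "companion d A i j =
     (if j = d then (if i = d then A 0 else 0)
      else if i = 0 then - A (Suc j)
      else if i = Suc j \<and> i \<noteq> d then A 0 else 0)"

lemma degree_companion:
  assumes "\<And>i. i \<le> d \<Longrightarrow> degree (A i) \<le> H" "i \<le> d" "j \<le> d"
  shows "degree (companion d A i j) \<le> H"
  using assms by (auto simp: companion_def)

section \<open>The Mahler system on the orbit of a/b\<close>

locale mahler_point =
  fixes k d H :: nat and A :: "nat \<Rightarrow> int poly" and F :: "int fps" and a b :: int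
  assumes k: "k \<ge> 2" and d: "d \<ge> 1"
    and deg: "\<And>i. i \<le> d \<Longrightarrow> degree (A i) \<le> H"
    and mahler: "(\<Sum>i=0..d. fps_of_poly (A i) * (F oo fps_X ^ (k ^ i))) = 0"
    and a: "a \<noteq> 0" and b: "b \<ge> 2"
    and radius: "ereal \<bar>of_int a / of_int b\<bar> < fps_conv_radius (real_fps_of_int_fps F)"
    and size: "ln \<bar>real_of_int a\<bar> / ln (real_of_int b) < 1 / (real d + 2)"
    and A0: "\<And>n::nat. poly (map_poly real_of_int (A 0)) ((of_int a / of_int b) ^ (k ^ n)) \<noteq> 0"
begin

definition x0 :: real where "x0 = of_int a / of_int b"

definition f :: "nat \<Rightarrow> real" where "f n = eval_fps (real_fps_of_int_fps F) (x0 ^ (k ^ n))"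

abbreviation base_row :: "(nat \<Rightarrow> real) \<Rightarrow> nat \<Rightarrow> nat \<Rightarrow> real" where
  "base_row \<equiv> transfer_row (companion d A) {..d} k x0"

text \<open>The factor gained when the companion identity, which carries \<open>A 0\<close>, is
  iterated n times.\<close>

definition W :: "nat \<Rightarrow> real" where "W n = (\<Prod>l<n. ipoly (A 0) (x0 ^ (k ^ l)))"

definition basis_vec :: "nat \<Rightarrow> nat \<Rightarrow> real" where "basis_vec i j = (if j = i then 1 else 0)"

lemma x0_nz: "x0 \<noteq> 0" using a b by (simp add: x0_def)

text \<open>The size condition says |a| < b^(1/(d+2)); dividing by b leaves the exponent 1/(d+2) -
  1.\<close>

lemma x0_le: "\<bar>x0\<bar> \<le> of_int b powr (- ((real d + 1) / (real d + 2)))"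
proof -
  have lnb: "ln (real_of_int b) > 0" using b by simp
  then have "ln \<bar>real_of_int a\<bar> < 1 / (real d + 2) * ln (real_of_int b)"
    using size by (simp add: pos_divide_less_eq)
  then have "exp (ln \<bar>real_of_int a\<bar>) \<le> of_int b powr (1 / (real d + 2))"
    using b by (simp add: powr_def)
  then have "\<bar>real_of_int a\<bar> \<le> of_int b powr (1 / (real d + 2))" using a by simp
  moreover have "1 / (real d + 2) = 1 + - ((real d + 1) / (real d + 2))" by (simp add: field_simps)
  then have "of_int b powr (1 / (real d + 2)) = of_int b * real_of_int b powr (- ((real d + 1) / (real d + 2)))"
    using b powr_add[of "real_of_int b" 1] by (simp only:) simp
  ultimately show ?thesis using b by (simp add: x0_def field_simps)
qed

lemma x0_lt_1: "\<bar>x0\<bar> < 1"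
proof -
  have "of_int b powr (- ((real d + 1) / (real d + 2))) < of_int b powr 0"
    using b by (intro powr_less_mono) auto
  then show ?thesis using x0_le b by simp
qed

lemma inj_x0: "inj (\<lambda>n::nat. x0 ^ (k ^ n))"
proof (rule injI)
  fix m n :: nat
  assume "x0 ^ (k ^ m) = x0 ^ (k ^ n)"
  then have "\<bar>x0\<bar> ^ (k ^ m) = \<bar>x0\<bar> ^ (k ^ n)" by (metis power_abs)
  then have "k ^ m = k ^ n"
    using x0_nz x0_lt_1 power_strict_decreasing_iff[of "\<bar>x0\<bar>"]
    by (metis linorder_neqE_nat less_irrefl zero_less_abs_iff)
  then show "m = n" using k by (simp add: power_inject_exp)
qed

lemma abs_x0_power: "n > 0 \<Longrightarrow> \<bar>x0 ^ n\<bar> \<le> \<bar>x0\<bar>"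
  using x0_lt_1 power_decreasing[of 1 n "\<bar>x0\<bar>"] by (simp add: power_abs)

lemma x0_power_radius: "n > 0 \<Longrightarrow> ereal \<bar>x0 ^ n\<bar> < fps_conv_radius (real_fps_of_int_fps F)"
  using abs_x0_power[of n] radius unfolding x0_def[symmetric]
  by (meson ereal_less_eq(3) le_less_trans)

lemma x0_power_lt_1: "n > 0 \<Longrightarrow> \<bar>x0 ^ n\<bar> < 1"
  using abs_x0_power[of n] x0_lt_1 by linarith

lemma functional_equation: "(\<Sum>i\<le>d. ipoly (A i) (x0 ^ (k ^ n)) * f (n + i)) = 0"
proof -
  let ?y = "x0 ^ (k ^ n)"
  have kn: "k ^ n > 0" for n using k by simp
  note comp = eval_compose_X_power[OF kn x0_power_lt_1[OF kn] x0_power_radius[OF kn]]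
  have "eval_fps (real_fps_of_int_fps (\<Sum>i=0..d. fps_of_poly (A i) * (F oo fps_X ^ (k ^ i)))) ?y =
      (\<Sum>i=0..d. eval_fps (real_fps_of_int_fps (fps_of_poly (A i) * (F oo fps_X ^ (k ^ i)))) ?y)"
    using eval_mult_fps_of_poly(1)[OF comp(1)] by (intro conjunct2[OF eval_sum_int_fps])
  also have "\<dots> = (\<Sum>i=0..d. ipoly (A i) ?y * f (n + i))"
    unfolding eval_mult_fps_of_poly(2)[OF comp(1)] comp(2) f_def
    by (simp add: power_mult[symmetric] power_add)
  finally show ?thesis using mahler by (simp add: atLeast0AtMost)
qed

text \<open>The companion matrix at an orbit point sends the values of F at the next level to
  \<open>A 0\<close> times those at the current level. A zero at index d masks the constant
  function, whose block is separate.\<close>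

lemma companion_row_invariant:
  "(\<Sum>j\<le>d. base_row w n j * (if j = d then 0 else f (n + j))) =
     W n * (\<Sum>j\<le>d. w j * (if j = d then 0 else f j))"
proof (induction n)
  case 0 then show ?case by (simp add: W_def cong: if_cong)
next
  case (Suc n)
  let ?x = "x0 ^ (k ^ n)"
  have step: "(\<Sum>j\<le>d. ipoly (companion d A i j) ?x * (if j = d then 0 else f (Suc n + j))) =
      ipoly (A 0) ?x * (if i = d then 0 else f (n + i))" if "i \<le> d" for i
  proof -
    have "(\<Sum>j\<le>d. ipoly (companion d A i j) ?x * (if j = d then 0 else f (Suc n + j))) =
        (\<Sum>j<d. ipoly (companion d A i j) ?x * f (Suc n + j))"
      by (simp add: lessThan_Suc_atMost[symmetric])
    also have "\<dots> = ipoly (A 0) ?x * (if i = d then 0 else f (n + i))"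
    \<comment> \<open>Row 0 is the functional equation solved for its first term; a row 0 < i < d
      has its only entry in column i - 1 and merely shifts.\<close>
    proof (cases "i = 0")
      case True
      have "(\<Sum>i\<le>d. ipoly (A i) ?x * f (n + i)) =
          ipoly (A 0) ?x * f n + (\<Sum>j<d. ipoly (A (Suc j)) ?x * f (n + Suc j))"
        by (simp add: lessThan_Suc_atMost[symmetric] sum.lessThan_Suc_shift del: sum.lessThan_Suc)
      then show ?thesis using functional_equation[of n] True d
        by (simp add: companion_def ipoly_minus sum_negf)
    next
      case False
      then have "(\<Sum>j<d. ipoly (companion d A i j) ?x * f (Suc n + j)) =
          (\<Sum>j<d. if j = i - 1 then (if i = d then 0 else ipoly (A 0) ?x * f (n + i)) else 0)"
        by (intro sum.cong) (auto simp: companion_def)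
      moreover have "i - 1 < d" using that d by linarith
      ultimately show ?thesis by simp
    qed
    finally show ?thesis .
  qed
  have "(\<Sum>j\<le>d. base_row w (Suc n) j * (if j = d then 0 else f (Suc n + j))) =
     (\<Sum>j\<le>d. \<Sum>i\<le>d. base_row w n i * (ipoly (companion d A i j) ?x * (if j = d then 0 else f (Suc n + j))))"
    by (simp add: sum_distrib_right mult.assoc)
  also have "\<dots> = (\<Sum>i\<le>d. \<Sum>j\<le>d. base_row w n i * (ipoly (companion d A i j) ?x * (if j = d then 0 else f (Suc n + j))))"
    by (rule sum.swap)
  also have "\<dots> = (\<Sum>i\<le>d. base_row w n i * (ipoly (A 0) ?x * (if i = d then 0 else f (n + i))))"
    unfolding sum_distrib_left[symmetric] using step by (intro sum.cong) auto
  also have "\<dots> = ipoly (A 0) ?x * (\<Sum>i\<le>d. base_row w n i * (if i = d then 0 else f (n + i)))"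
    unfolding sum_distrib_left by (intro sum.cong) (auto simp: mult_ac)
  finally show ?case unfolding Suc.IH by (simp add: W_def)
qed

text \<open>Column d of the companion matrix has only its diagonal entry \<open>A 0\<close>.\<close>

lemma base_row_last: "base_row w n d = W n * w d"
proof (induction n)
  case (Suc n)
  have "(\<Sum>i\<le>d. base_row w n i * ipoly (companion d A i d) (x0 ^ (k ^ n))) =
      (\<Sum>i\<le>d. if i = d then base_row w n d * ipoly (A 0) (x0 ^ (k ^ n)) else 0)"
    by (intro sum.cong) (auto simp: companion_def)
  then show ?case using Suc by (simp add: W_def)
qed (simp add: W_def)

text \<open>Row d is zero off the diagonal, so the unit row at d never spreads.\<close>

lemma base_row_basis_vec_last: "j < d \<Longrightarrow> base_row (basis_vec d) n j = 0"
proof (induction n arbitrary: j)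
  case (Suc n)
  have "base_row (basis_vec d) n i * ipoly (companion d A i j) (x0 ^ (k ^ n)) = 0" if "i \<le> d" for i
  proof (cases "i = d")
    case True
    then show ?thesis using Suc.prems d by (simp add: companion_def)
  next
    case False
    then show ?thesis using Suc.IH[of i] that by simp
  qed
  then show ?case unfolding transfer_row.simps by (intro sum.neutral ballI) (simp only: atMost_iff)
qed (simp add: basis_vec_def)

lemma W_nz: "W n \<noteq> 0"
  using A0 by (simp add: W_def x0_def)

lemma base_row_basis_vec_0_sum: "(\<Sum>j<d. base_row (basis_vec 0) n j * f (n + j)) = W n * f 0"
proof -
  have "(\<Sum>j<d. base_row (basis_vec 0) n j * f (n + j)) =
      (\<Sum>j\<le>d. base_row (basis_vec 0) n j * (if j = d then 0 else f (n + j)))"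
    by (simp add: lessThan_Suc_atMost[symmetric])
  also have "\<dots> = W n * (\<Sum>j\<le>d. basis_vec 0 j * (if j = d then 0 else f j))"
    by (rule companion_row_invariant)
  also have "(\<Sum>j\<le>d. basis_vec 0 j * (if j = d then 0 else f j)) = (\<Sum>j\<le>d. if j = 0 then f 0 else 0)"
    using d by (intro sum.cong) (auto simp: basis_vec_def)
  also have "\<dots> = f 0" by simp
  finally show ?thesis .
qed

section \<open>Approximations to F(a/b) and the exponent they give\<close>

lemma irrationality_exponent_value:
  "irrationality_exponent (f 0) \<le> ereal (1 + 2 * (real H * (real d + 1)\<^sup>2 + 1) * real k ^ (d + 1))"
proof (cases "f 0 \<in> \<rat>")
  case True
  then have "irrationality_exponent (f 0) \<le> ereal 1" by (rule irrationality_exponent_Rats_le)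
  also have "\<dots> \<le> ereal (1 + 2 * (real H * (real d + 1)\<^sup>2 + 1) * real k ^ (d + 1))" by simp
  finally show ?thesis .
next
  case irrational: False
  \<comment> \<open>The factor d + 2 matches the bound |a/b| \<le> b^(-\<sigma>) with \<sigma> =
    (d+1)/(d+2): then \<sigma> E = D + \<sigma>. The D cancels the cleared denominators, and the
    final + 1 in \<open>E\<close> leaves the gain \<sigma>.\<close>
  define t where "t = (d + 2) * H"
  define N where "N = d * t"
  define E where "E = (d + 1) * t + 1"
  define D where "D = H * (d + 1)\<^sup>2"
  have NH: "N + H = D" by (simp add: N_def t_def D_def power2_eq_square algebra_simps)
  obtain Q P where QP: "Q \<noteq> 0" "degree Q \<le> N" "\<And>i. degree (P i) \<le> N"
    "\<And>i e. i < d \<Longrightarrow> e < E \<Longrightarrow>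
       (fps_of_poly Q * (F oo fps_X ^ (k ^ i)) - fps_of_poly (P i)) $ e = 0"
    using simultaneous_Pade[of d t "\<lambda>i. F oo fps_X ^ (k ^ i)"] unfolding N_def E_def by blast
  \<comment> \<open>\<open>v\<close> approximates Q times the vector of functions: index d carries
    the constant 1, hence Q itself.\<close>
  define v where "v j = (if j = d then Q else P j)" for j
  let ?x = "\<lambda>n. x0 ^ (k ^ n)"
  \<comment> \<open>\<open>q'\<close> and \<open>p'\<close> differ only in the starting row, so
    every \<open>p' - \<theta> q'\<close> is again a transferred row applied to the same column
    \<open>v\<close>.\<close>
  define q' where "q' n = (\<Sum>j\<le>d. base_row (basis_vec d) n j * ipoly (v j) (?x n))" for n
  define p' where "p' n = (\<Sum>j\<le>d. base_row (basis_vec 0) n j * ipoly (v j) (?x n))" for n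
  have q'_eq: "q' n = W n * ipoly Q (?x n)" for n
  proof -
    have "q' n = (\<Sum>j<d. base_row (basis_vec d) n j * ipoly (v j) (?x n)) + base_row (basis_vec d) n d * ipoly (v d) (?x n)"
      by (simp add: q'_def lessThan_Suc_atMost[symmetric])
    then show ?thesis using base_row_basis_vec_last by (simp add: base_row_last v_def basis_vec_def)
  qed
  have p'_eq: "p' n = (\<Sum>j<d. base_row (basis_vec 0) n j * ipoly (P j) (?x n))" for n
  proof -
    have "p' n = (\<Sum>j<d. base_row (basis_vec 0) n j * ipoly (v j) (?x n)) + base_row (basis_vec 0) n d * ipoly (v d) (?x n)"
      by (simp add: p'_def lessThan_Suc_atMost[symmetric])
    then show ?thesis using d by (simp add: base_row_last v_def basis_vec_def)
  qed

  define R where "R i = real_fps_of_int_fps (fps_of_poly Q * (F oo fps_X ^ (k ^ i)) - fps_of_poly (P i))" for i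
  have kn: "k ^ n > 0" for n using k by simp
  note comp = eval_compose_X_power[OF kn x0_power_lt_1[OF kn] x0_power_radius[OF kn]]
  have comp_radius: "ereal \<bar>?x n\<bar> < fps_conv_radius (real_fps_of_int_fps (fps_of_poly Q * (F oo fps_X ^ (k ^ i))))" for n i
    by (intro eval_mult_fps_of_poly(1) comp(1))
  have R_eval: "eval_fps (R i) (?x n) = ipoly Q (?x n) * f (n + i) - ipoly (P i) (?x n)" for i n
  proof -
    have "eval_fps (R i) (?x n) =
      eval_fps (real_fps_of_int_fps (fps_of_poly Q * (F oo fps_X ^ (k ^ i)))) (?x n) - ipoly (P i) (?x n)"
      unfolding R_def real_fps_of_int_fps_diff real_fps_of_int_fps_of_poly
      by (subst eval_fps_diff) (use comp_radius in auto)
    also have "eval_fps (real_fps_of_int_fps (fps_of_poly Q * (F oo fps_X ^ (k ^ i)))) (?x n) =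
        ipoly Q (?x n) * eval_fps (real_fps_of_int_fps F) (?x n ^ (k ^ i))"
      by (simp only: comp eval_mult_fps_of_poly(2)[OF comp(1)])
    finally show ?thesis by (simp add: f_def power_mult[symmetric] power_add)
  qed
  have "\<exists>c\<ge>0. \<forall>y. \<bar>y\<bar> \<le> \<bar>x0\<bar> \<longrightarrow> \<bar>eval_fps (R i) y\<bar> \<le> c * \<bar>y\<bar> ^ E" if i: "i < d" for i
  proof -
    have "ereal \<bar>x0\<bar> < fps_conv_radius (R i)"
      unfolding R_def real_fps_of_int_fps_diff real_fps_of_int_fps_of_poly
      by (rule less_le_trans[OF _ fps_conv_radius_diff]) (use comp_radius[of 0 i] in simp)
    moreover have "R i $ e = 0" if "e < E" for e
      using QP(4)[OF i that] unfolding R_def real_fps_of_int_fps_nth by simp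
    ultimately show ?thesis using eval_fps_high_order[of E "R i" "\<bar>x0\<bar>"] by (metis abs_ge_zero)
  qed
  then obtain c where c: "\<And>i. i < d \<Longrightarrow> c i \<ge> 0"
    "\<And>i y. i < d \<Longrightarrow> \<bar>y\<bar> \<le> \<bar>x0\<bar> \<Longrightarrow> \<bar>eval_fps (R i) y\<bar> \<le> c i * \<bar>y\<bar> ^ E" by metis

  \<comment> \<open>The first summand clears the denominators of the matrix product, the second
    those of \<open>v\<close> at x_n.\<close>
  define e where "e n = H * (\<Sum>i<n. k ^ i) + N * k ^ n" for n
  have "real_of_int b ^ e n * (base_row (basis_vec i) n j * ipoly (v j) (?x n)) \<in> \<int>" if "j \<le> d" for i j n
  proof -
    have "(of_int b ^ (H * (\<Sum>i<n. k ^ i)) * base_row (basis_vec i) n j) *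
        (of_int b ^ (N * k ^ n) * ipoly (v j) (?x n)) \<in> \<int>"
      unfolding x0_def using b that QP(2,3)
      by (intro Ints_mult transfer_row_Ints ipoly_Ints_scaled)
        (auto simp: v_def basis_vec_def intro!: degree_companion deg)
    then show ?thesis by (simp add: e_def power_add mult_ac)
  qed
  then have ints: "real_of_int b ^ e n * q' n \<in> \<int>" "real_of_int b ^ e n * p' n \<in> \<int>" for n
    unfolding q'_def p'_def sum_distrib_left by (intro Ints_sum; simp)+
  define q where "q n = \<lfloor>real_of_int b ^ e n * q' n\<rfloor>" for n
  define p where "p n = \<lfloor>real_of_int b ^ e n * p' n\<rfloor>" for n
  have q: "real_of_int (q n) = of_int b ^ e n * q' n" and p: "real_of_int (p n) = of_int b ^ e n * p' n" for n
    using ints[of n] by (simp_all add: q_def p_def)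

  have geom: "(\<Sum>i<n. k ^ i) \<le> k ^ n" for n
  proof (induction n)
    case (Suc n)
    have "(\<Sum>i<Suc n. k ^ i) \<le> 2 * k ^ n" using Suc by simp
    also have "\<dots> \<le> k * k ^ n" using k by (intro mult_right_mono) auto
    finally show ?case by simp
  qed simp
  have b1: "real_of_int b > 1" using b by simp
  have b_e: "real_of_int b ^ e n \<le> of_int b powr (real D * real k ^ n)" for n
  proof -
    have "e n \<le> D * k ^ n" unfolding NH[symmetric] e_def using geom[of n] by (simp add: algebra_simps)
    then have "real_of_int b ^ e n \<le> of_int b ^ (D * k ^ n)" using b1 by (intro power_increasing) auto
    also have "\<dots> = of_int b powr (real D * real k ^ n)"
      using b1 by (simp flip: powr_realpow)
    finally show ?thesis .
  qed
  have x_le_1: "\<bar>?x n\<bar> \<le> 1" for n using x0_power_lt_1[OF kn[of n]] by simp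

  obtain C1 where C1: "C1 \<ge> 1" "\<And>n j. j \<in> {..d} \<Longrightarrow> \<bar>base_row (basis_vec d) n j\<bar> \<le> C1 ^ Suc n"
    using transfer_row_bound[of "{..d}" x0 "companion d A" k "basis_vec d"] x0_lt_1 by auto
  obtain C2 where C2: "C2 \<ge> 1" "\<And>n j. j \<in> {..d} \<Longrightarrow> \<bar>base_row (basis_vec 0) n j\<bar> \<le> C2 ^ Suc n"
    using transfer_row_bound[of "{..d}" x0 "companion d A" k "basis_vec 0"] x0_lt_1 by auto
  obtain B where B: "B > 0" "\<And>y. \<bar>y\<bar> \<le> 1 \<Longrightarrow> \<bar>ipoly Q y\<bar> \<le> B" using ipoly_bounded_unit by blast
  define S where "S = (\<Sum>i<d. c i)"

  have denom: "eventually (\<lambda>n. \<bar>real_of_int (q n)\<bar> \<le> of_int b powr ((real D + 1) * real k ^ n)) sequentially"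
    using eventually_exponential_le[OF C1(1) b1 zero_less_one k, of B]
  proof eventually_elim
    case (elim n)
    \<comment> \<open>\<open>W n\<close> is itself the last entry of a transferred row.\<close>
    have "\<bar>W n\<bar> \<le> C1 ^ Suc n" using C1(2)[of d n] by (simp add: base_row_last basis_vec_def)
    then have "\<bar>q' n\<bar> \<le> C1 ^ Suc n * B"
      unfolding q'_eq abs_mult using B(2)[OF x_le_1] C1 by (intro mult_mono) auto
    also have "\<dots> \<le> of_int b powr (real k ^ n)" using elim by (simp add: mult_ac)
    finally have "\<bar>real_of_int (q n)\<bar> \<le> of_int b powr (real D * real k ^ n) * of_int b powr (real k ^ n)"
      unfolding q abs_mult using b_e[of n] b1 by (intro mult_mono) auto
    then show ?case by (simp add: powr_add[symmetric] algebra_simps)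
  qed

  \<comment> \<open>The choice 1/6 fits \<sigma> \<ge> 2/3, which holds as d \<ge> 1: it leaves 2/3
    - 1/6 = 1/2.\<close>
  have "eventually (\<lambda>n. S * C2 ^ Suc n \<le> of_int b powr (1 / 6 * real k ^ n)) sequentially"
    by (rule eventually_exponential_le[OF C2(1) b1 _ k]) simp
  then have approx: "eventually (\<lambda>n. \<bar>of_int (q n) * f 0 - of_int (p n)\<bar> \<le>
      of_int b powr (- (1 / 2) * real k ^ n)) sequentially"
  proof eventually_elim
    case (elim n)
    define \<sigma> where "\<sigma> = (real d + 1) / (real d + 2)"
    have "q' n * f 0 - p' n = (\<Sum>j<d. base_row (basis_vec 0) n j * eval_fps (R j) (?x n))"
    proof -
      have "q' n * f 0 = (\<Sum>j<d. base_row (basis_vec 0) n j * f (n + j)) * ipoly Q (?x n)"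
        unfolding q'_eq base_row_basis_vec_0_sum by simp
      then show ?thesis
        unfolding p'_eq R_eval right_diff_distrib sum_subtractf by (simp add: sum_distrib_left mult_ac)
    qed
    then have "\<bar>q' n * f 0 - p' n\<bar> \<le> (\<Sum>j<d. \<bar>base_row (basis_vec 0) n j * eval_fps (R j) (?x n)\<bar>)"
      by simp
    also have "\<dots> \<le> (\<Sum>j<d. C2 ^ Suc n * (c j * \<bar>?x n\<bar> ^ E))"
      unfolding abs_mult using C2 c abs_x0_power[OF kn]
      by (intro sum_mono mult_mono) auto
    also have "\<dots> = S * C2 ^ Suc n * \<bar>?x n\<bar> ^ E"
      by (simp add: S_def sum_distrib_left sum_distrib_right mult_ac)
    also have "\<dots> \<le> of_int b powr (1 / 6 * real k ^ n) * \<bar>?x n\<bar> ^ E"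
      using elim by (intro mult_right_mono) auto
    also have "\<bar>?x n\<bar> ^ E = \<bar>x0\<bar> ^ (k ^ n * E)" by (simp add: power_abs power_mult)
    also have "\<dots> \<le> (of_int b powr (- \<sigma>)) ^ (k ^ n * E)"
      unfolding \<sigma>_def by (intro power_mono x0_le) auto
    also have "\<dots> = of_int b powr (- \<sigma> * (real k ^ n * real E))"
      using b1 by (simp add: powr_realpow[symmetric] powr_powr)
    finally have "\<bar>q' n * f 0 - p' n\<bar> \<le> of_int b powr (1 / 6 * real k ^ n) * of_int b powr (- \<sigma> * (real k ^ n * real E))"
      by (simp add: mult_left_mono)
    then have "real_of_int b ^ e n * \<bar>q' n * f 0 - p' n\<bar> \<le>
        of_int b powr (real D * real k ^ n) * (of_int b powr (1 / 6 * real k ^ n) * of_int b powr (- \<sigma> * (real k ^ n * real E)))"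
      using b_e[of n] b1 by (intro mult_mono) auto
    also have "\<dots> = of_int b powr ((real D + 1 / 6 - \<sigma> * real E) * real k ^ n)"
      by (simp add: powr_add[symmetric] algebra_simps)
    also have "\<sigma> * real E = real D + \<sigma>"
    proof -
      have "real E = (real d + 1) * ((real d + 2) * real H) + 1" by (simp add: E_def t_def algebra_simps)
      moreover have "\<sigma> * (real d + 2) = real d + 1" by (simp add: \<sigma>_def)
      then have "\<sigma> * ((real d + 1) * ((real d + 2) * real H) + 1) = (real d + 1) * (real d + 1) * real H + \<sigma>"
        by algebra
      moreover have "real D = (real d + 1) * (real d + 1) * real H"
        by (simp add: D_def power2_eq_square algebra_simps)
      ultimately show ?thesis by (simp only:)
    qed
    also have "of_int b powr ((real D + 1 / 6 - (real D + \<sigma>)) * real k ^ n) \<le> of_int b powr (- (1 / 2) * real k ^ n)"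
    proof -
      have "\<sigma> \<ge> 2 / 3" using d by (simp add: \<sigma>_def field_simps)
      then show ?thesis using b1 by (intro powr_mono mult_right_mono) auto
    qed
    also have "real_of_int b ^ e n * \<bar>q' n * f 0 - p' n\<bar> = \<bar>of_int (q n) * f 0 - of_int (p n)\<bar>"
    proof -
      have "of_int (q n) * f 0 - of_int (p n) = real_of_int b ^ e n * (q' n * f 0 - p' n)"
        unfolding q p by (simp add: algebra_simps)
      then show ?thesis using b1 by (simp add: abs_mult)
    qed
    finally show ?case .
  qed

  have "eventually (\<lambda>n. ipoly Q (?x n) \<noteq> 0) sequentially"
    using finite_ipoly_zeros_seq[OF QP(1) inj_x0]
    by (simp add: cofinite_eq_sequentially[symmetric] eventually_cofinite)
  then have q_nz: "eventually (\<lambda>n. q n \<noteq> 0) sequentially"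
  proof eventually_elim
    case (elim n)
    then have "real_of_int (q n) \<noteq> 0" unfolding q q'_eq using W_nz b1 by simp
    then show ?case by simp
  qed

  have card_I: "card {..d} = Suc d" by simp
  obtain n1 where propagate: "\<And>w n m. n \<ge> n1 \<Longrightarrow> n \<le> m \<Longrightarrow>
      (\<And>l. l \<in> {n..<n + card {..d}} \<Longrightarrow> (\<Sum>j\<le>d. base_row w l j * ipoly (v j) (?x l)) = 0) \<Longrightarrow>
      (\<Sum>j\<le>d. base_row w m j * ipoly (v j) (?x m)) = 0"
    using vanishing_propagates[OF finite_atMost[of d] inj_x0, of "companion d A" v] by blast

  obtain n0 where n0: "\<And>n. n \<ge> n0 \<Longrightarrow> \<bar>real_of_int (q n)\<bar> \<le> of_int b powr ((real D + 1) * real k ^ n)"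
    "\<And>n. n \<ge> n0 \<Longrightarrow> \<bar>of_int (q n) * f 0 - of_int (p n)\<bar> \<le> of_int b powr (- (1 / 2) * real k ^ n)"
    "\<And>n. n \<ge> n0 \<Longrightarrow> q n \<noteq> 0" "n0 \<ge> n1"
    using eventually_conj[OF denom eventually_conj[OF approx eventually_conj[OF q_nz eventually_ge_at_top[of n1]]]]
    unfolding eventually_sequentially by (metis order_refl)

  have distinct: "\<exists>m\<in>{n..n + d}. q m * r \<noteq> p m * s" if n: "n \<ge> n0" and s: "s > 0" for n r s
  proof (rule ccontr)
    assume "\<not> ?thesis"
    then have eq: "q m * r = p m * s" if "m \<in> {n..n + d}" for m using that by blast
    define \<theta> where "\<theta> = real_of_int r / of_int s"
    \<comment> \<open>This row encodes \<open>p' - \<theta> q'\<close>. The indices n..n+d form a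
      window of exactly \<open>card {..d}\<close> zeros, which then propagate.\<close>
    define w where "w j = - \<theta> * basis_vec d j + basis_vec 0 j" for j
    have L: "(\<Sum>j\<le>d. base_row w m j * ipoly (v j) (?x m)) = p' m - \<theta> * q' m" for m
      unfolding w_def transfer_row_linear p'_def q'_def
      by (simp add: sum_distrib_left distrib_right sum.distrib mult_ac sum_subtractf algebra_simps)
    have "p' m - \<theta> * q' m = 0" if "m \<in> {n..n + d}" for m
    proof -
      have "real_of_int (q m) * of_int r = of_int (p m) * of_int s"
        using eq[OF that] by (metis of_int_mult)
      then have "real_of_int b ^ e m * (q' m * of_int r) = real_of_int b ^ e m * (p' m * of_int s)"
        unfolding q p by (simp add: mult_ac)
      then have "q' m * of_int r = p' m * of_int s" using b1 by simp
      then show ?thesis using s by (simp add: \<theta>_def field_simps)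
    qed
    then have L0: "p' m - \<theta> * q' m = 0" if "m \<ge> n" for m
      using propagate[of n m w] that n n0(4) unfolding L card_I by auto
    \<comment> \<open>Since q_m is a nonzero integer, |f 0 - \<theta>| is at most the approximation
      error, which tends to 0; so \<open>f 0\<close> would be rational.\<close>
    have close: "\<bar>f 0 - \<theta>\<bar> \<le> of_int b powr (- (1 / 2) * real k ^ m)" if m: "m \<ge> n" for m
    proof -
      have "real_of_int (p m) = \<theta> * of_int (q m)" unfolding p q using L0[OF m] by simp
      then have "of_int (q m) * f 0 - of_int (p m) = real_of_int (q m) * (f 0 - \<theta>)"
        by (simp add: algebra_simps)
      then have "\<bar>real_of_int (q m)\<bar> * \<bar>f 0 - \<theta>\<bar> \<le> of_int b powr (- (1 / 2) * real k ^ m)"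
        using n0(2)[of m] m n by (simp add: abs_mult)
      moreover have "1 \<le> \<bar>real_of_int (q m)\<bar>" using n0(3)[of m] m n by linarith
      then have "1 * \<bar>f 0 - \<theta>\<bar> \<le> \<bar>real_of_int (q m)\<bar> * \<bar>f 0 - \<theta>\<bar>" by (intro mult_right_mono) auto
      ultimately show ?thesis by simp
    qed
    have "f 0 \<noteq> \<theta>" using irrational by (auto simp: \<theta>_def)
    then have pos: "\<bar>f 0 - \<theta>\<bar> > 0" by simp
    have "eventually (\<lambda>m. 2 / \<bar>f 0 - \<theta>\<bar> * 1 ^ Suc m \<le> of_int b powr (1 / 2 * real k ^ m)) sequentially"
      by (rule eventually_exponential_le[OF _ b1 _ k]) auto
    from eventually_conj[OF this eventually_ge_at_top[of n]]
    obtain m where m: "2 / \<bar>f 0 - \<theta>\<bar> \<le> of_int b powr (1 / 2 * real k ^ m)" "m \<ge> n"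
      unfolding eventually_sequentially by auto
    have "of_int b powr (1 / 2 * real k ^ m) * \<bar>f 0 - \<theta>\<bar> \<le>
        of_int b powr (1 / 2 * real k ^ m) * of_int b powr (- (1 / 2) * real k ^ m)"
      by (intro mult_left_mono close m(2)) simp
    also have "\<dots> = 1" using b1 by (simp add: powr_add[symmetric])
    finally show False using m(1) pos by (simp add: pos_divide_le_eq)
  qed

  have "irrationality_exponent (f 0) \<le> ereal (1 + (real D + 1) / (1 / 2) * real k ^ (d + 1))"
    using n0(1,2) distinct
    by (intro irrationality_exponent_le_of_approximations[OF b1 k, of "1 / 2" "real D + 1" n0 q _ p d]) auto
  then show ?thesis by (simp add: D_def mult_ac add_ac)
qed

end

section \<open>Comparison with the claimed bound\<close>

text \<open>With y = k^(d+1) and X the power of 4, the left side is at most (3 + 2X) y \<le> 8Xy.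
  The 8 is absorbed by k^3, since d + 4 \<le> 5d^2, and H(d+1)^2 \<le> 4Hd^2 \<le> X.\<close>

lemma exponent_bound_le:
  fixes k d H :: nat
  assumes "k \<ge> 2" "d \<ge> 1"
  shows "1 + 2 * (real H * (real d + 1)\<^sup>2 + 1) * real k ^ (d + 1) \<le>
    4 ^ (H * (k ^ d + 1) * d\<^sup>2) * real k ^ (5 * d\<^sup>2)"
proof -
  define y where "y = real k ^ (d + 1)"
  define X where "X = (4::real) ^ (H * (k ^ d + 1) * d\<^sup>2)"
  have y: "y \<ge> 1" unfolding y_def using assms by (intro one_le_power) simp
  have X: "X \<ge> 1" unfolding X_def by (intro one_le_power) simp
  have "d \<le> d\<^sup>2" by (simp add: power2_eq_square)
  then have "d + 1 + 3 \<le> 5 * d\<^sup>2" using assms(2) by linarith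
  then have "real k ^ (d + 1 + 3) \<le> real k ^ (5 * d\<^sup>2)" using assms by (intro power_increasing) auto
  moreover have "2 ^ 3 \<le> real k ^ 3" using assms by (intro power_mono) auto
  then have "8 * y \<le> real k ^ (d + 1 + 3)"
    unfolding power_add[of _ "d + 1"] y_def using mult_left_mono[of 8 "real k ^ 3" "real k ^ (d + 1)"] by simp
  ultimately have large: "8 * y \<le> real k ^ (5 * d\<^sup>2)" by linarith
  have "real H * (real d + 1)\<^sup>2 \<le> real H * (2 * real d)\<^sup>2"
    using assms by (intro mult_left_mono power_mono) auto
  also have "\<dots> \<le> real 4 * real (H * d\<^sup>2)" by (simp add: power2_eq_square)
  also have "\<dots> \<le> 4 ^ (2 * (H * d\<^sup>2))"
  proof (cases "H * d\<^sup>2 = 0")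
    case False
    have "real (H * d\<^sup>2) \<le> 4 ^ (H * d\<^sup>2)"
      using of_nat_less_two_power[of "H * d\<^sup>2", where 'a=real] power_mono[of "2::real" 4 "H * d\<^sup>2"]
      by linarith
    then have "4 * real (H * d\<^sup>2) \<le> 4 ^ 1 * 4 ^ (H * d\<^sup>2)" by (simp del: of_nat_mult of_nat_power)
    also have "\<dots> \<le> 4 ^ (H * d\<^sup>2) * 4 ^ (H * d\<^sup>2)"
      using False by (intro mult_right_mono power_increasing) auto
    finally show ?thesis by (simp add: mult_2 power_add)
  qed auto
  also have "\<dots> \<le> X"
  proof -
    have "1 \<le> k ^ d" using assms by simp
    then have "2 * (H * d\<^sup>2) \<le> (k ^ d + 1) * (H * d\<^sup>2)" by (intro mult_right_mono) auto
    then show ?thesis unfolding X_def by (intro power_increasing) (auto simp: mult_ac)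
  qed
  finally have "1 + 2 * (real H * (real d + 1)\<^sup>2 + 1) * y \<le> y + 2 * (X + 1) * y"
    using y by (intro add_mono mult_right_mono) auto
  also have "\<dots> = (3 + 2 * X) * y" by (simp add: algebra_simps)
  also have "\<dots> \<le> (8 * X) * y" using y X by (intro mult_right_mono) auto
  also have "\<dots> \<le> X * real k ^ (5 * d\<^sup>2)" using large by (simp add: X_def)
  finally show ?thesis by (simp add: X_def y_def)
qed

theorem theorem4p1:
  fixes k d H :: nat and A :: "nat \<Rightarrow> int poly" and F :: "int fps" and a b :: int
  assumes "k \<ge> 2" and "d \<ge> 1"
    and "A 0 * A d \<noteq> 0"
    and "(\<Sum>i=0..d. fps_of_poly (A i) * fps_compose F (fps_X ^ (k ^ i))) = 0"
    and "a \<noteq> 0" and "b \<ge> 2"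
    and "ereal \<bar>of_int a / of_int b\<bar> < fps_conv_radius (real_fps_of_int_fps F)"
    and "ln \<bar>real_of_int a\<bar> / ln (real_of_int b) \<in> {0..<1 / (real d + 2)}"
    and "\<And>n::nat. poly (map_poly real_of_int (A 0)) ((of_int a / of_int b) ^ (k ^ n)) \<noteq> 0"
    and "H = Max {degree (A i) | i. i \<le> d}"
  shows "irrationality_exponent (eval_fps (real_fps_of_int_fps F) (of_int a / of_int b))
           \<le> ereal (4 ^ (H * (k ^ d + 1) * d\<^sup>2) * real k ^ (5 * d\<^sup>2))"
proof -
  have "finite {degree (A i) | i. i \<le> d}" by simp
  then have "degree (A i) \<le> H" if "i \<le> d" for i
    unfolding assms(10) using that by (intro Max_ge) auto
  then interpret mahler_point k d H A F a b
    using assms by unfold_locales auto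
  have "irrationality_exponent (f 0) \<le> ereal (4 ^ (H * (k ^ d + 1) * d\<^sup>2) * real k ^ (5 * d\<^sup>2))"
    using irrationality_exponent_value exponent_bound_le[OF assms(1,2), of H]
    by (meson ereal_less_eq(3) order_trans)
  then show ?thesis by (simp add: f_def x0_def)
qed

end
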